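(* Let $P,Q,R,S\in\mathbb{H}$ with $P\notin\mathbb{R}$, and write $P=p_0+\mathbf{p}$ with $p_0=\mathrm{scal}(P)$, $\mathbf{p}=\mathrm{vect}(P)\neq \mathbf{0}$. Consider the equation $$XPX^*+XQ+RX^*=S \qquad(\ast)$$ in the unknown $X\in\mathbb{H}$. Define $$\tilde R:=(Q^*P-RP^* )(P-P^* )^{-1},$$ $$\tilde S:=S+\frac{Q^*PR^*+RP^*Q}{|P-P^*|^2}+\frac{R(P^*-P)Q}{|P-P^*|^2}-\frac{Q^*P^*Q}{|P-P^*|^2}-\frac{RP^*R^*}{|P-P^*|^2},$$ and write $\tilde S=\tilde s_0+\tilde{\mathbf{s}}$ with $\tilde s_0=\mathrm{scal}(\tilde S)$, $\tilde{\mathbf{s}}=\mathrm{vect}(\tilde S)$. Then the solutions in $\mathbb{H}$ of $(\ast)$ are exactly the points $$X=Z-(R-Q^* )(P-P^* )^{-1},$$ where $Z\in\mathscr{C}_{\mathbf{p},\tilde{\mathbf{s}}}$ satisfies $$\langle Z,\tilde R\rangle=\frac{\tilde s_0|\mathbf{p}|-p_0|\tilde{\mathbf{s}}|}{2|\mathbf{p}|}. \qquad (\ast\ast)$$ Specifically: 1. If $\tilde S=0$, then $X=-(R-Q^* )(P-P^* )^{-1}$ is the unique solution of $(\ast)$. 2. If $\tilde S$ is a non-zero real number, then $(\ast)$ has no solution. 3. If $\tilde S$ is not a real number, then: (a) if $\tilde R\perp\Pi_{\mathbf{p},\tilde{\mathbf{s}}}$, the set of solutions $X$ of $(\ast)$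 is either the circle $\mathscr{C}_{\mathbf{p},\tilde{\mathbf{s}}}-(R-Q^* )(P-P^* )^{-1}$ or the empty set, depending on whether or not $\tilde s_0|\mathbf{p}|=p_0|\tilde{\mathbf{s}}|$; (b) if $\tilde R\not\perp\Pi_{\mathbf{p},\tilde{\mathbf{s}}}$, there are two, one, or no solutions of $(\ast)$, namely the points $X=Z-(R-Q^* )(P-P^* )^{-1}$ where $Z$ is an intersection point of the circle $\mathscr{C}_{\mathbf{p},\tilde{\mathbf{s}}}$ with the coplanar affine line obtained by intersecting $\Pi_{\mathbf{p},\tilde{\mathbf{s}}}$ with the hyperplane of all $Z\in\mathbb{H}$ satisfying $(\ast\ast)$.
   Context: $\mathbb{H}$ denotes the skew field of real quaternions, with standard real basis $1,\mathbf{i},\mathbf{j},\mathbf{k}$, identified as a vector space with Euclidean $\mathbb{R}^4$; $\mathbb{R}\subset\mathbb{H}$ is the real axis. For $X=x_0+x_1\mathbf{i}+x_2\mathbf{j}+x_3\mathbf{k}$: $\mathrm{scal}(X)=x_0$, $\mathrm{vect}(X)=x_1\mathbf{i}+x_2\mathbf{j}+x_3\mathbf{k}$, $X^*=\mathrm{scal}(X)-\mathrm{vect}(X)$ is the conjugate, and $|X|$ is the Euclidean norm, so $XX^*=X^*X=|X|^2$. $\langle\cdot,\cdot\rangle$ is the Euclidean scalar product on $\mathbb{H}=\mathbb{R}^4$ (so $\langle X,Y\rangle=\mathrm{scal}(XY^* )$) and $\perp$ denotes orthogonality with respect to it. A pure vector quaternion is one with zero scalar part; the space of these is $\mathrm{vect}(\mathbb{H})=\mathbb{R}\mathbf{i}+\mathbb{R}\mathbf{j}+\mathbb{R}\mathbf{k}$.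 For a non-zero pure vector quaternion $\mathbf{x}$, put $\hat{\mathbf{x}}=\mathbf{x}/|\mathbf{x}|$ and $\mathbb{C}_{\hat{\mathbf{x}}}=\mathbb{R}+\hat{\mathbf{x}}\,\mathbb{R}\subset\mathbb{H}$. For non-zero pure vector quaternions $\mathbf{p},\mathbf{s}$, the $2$-plane $\Pi_{\mathbf{p},\mathbf{s}}\subset\mathbb{H}$ is defined as follows. If $\hat{\mathbf{s}}\neq-\hat{\mathbf{p}}$, then $$\Pi_{\mathbf{p},\mathbf{s}}:=\mathbf{u}_{\mathbf{p},\mathbf{s}}\,\mathbb{C}_{\hat{\mathbf{p}}},\qquad \mathbf{u}_{\mathbf{p},\mathbf{s}}:=\frac{\hat{\mathbf{p}}+\hat{\mathbf{s}}}{|\hat{\mathbf{p}}+\hat{\mathbf{s}}|}.$$ If $\hat{\mathbf{s}}=-\hat{\mathbf{p}}$, then $\Pi_{\mathbf{p},\mathbf{s}}$ is the $2$-plane through the origin orthogonal to $\hat{\mathbf{p}}$ in the $3$-space $\mathrm{vect}(\mathbb{H})$. For pure vector quaternions $\mathbf{p}\neq\mathbf{0}$ and $\mathbf{s}$, $\mathscr{C}_{\mathbf{p},\mathbf{s}}$ denotes, if $\mathbf{s}\neq\mathbf{0}$, the circle in the $2$-plane $\Pi_{\mathbf{p},\mathbf{s}}$ with center $0$ and radius $\sqrt{|\mathbf{s}|/|\mathbf{p}|}$; and $\mathscr{C}_{\mathbf{p},\mathbf{0}}:=\{0\}$. *)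

theory Defs
  imports "HOL-Analysis.Analysis"
begin

section \<open>The skew field of real quaternions\<close>

text \<open>
  \<open>Quat a b c d\<close> is the quaternion \<open>a + b \<i> + c \<j> + d \<k>\<close>. The selector \<open>scal\<close> is the
  scalar part, as a real number. The type is made an instance of \<^class>\<open>real_normed_div_algebra\<close>
  and \<^class>\<open>euclidean_space\<close>, so \<open>of_real\<close> embeds the real axis, which is \<open>\<real>\<close>, and \<open>inner\<close>
  and \<open>norm\<close> are those of Euclidean 4-space with orthonormal basis \<open>1, \<i>, \<j>, \<k>\<close>.
\<close>

datatype quat = Quat (scal: real) (im_i: real) (im_j: real) (im_k: real)

lemma quat_eq_iff:
  "X = Y \<longleftrightarrow> scal X = scal Y \<and> im_i X = im_i Y \<and> im_j X = im_j Y \<and> im_k X = im_k Y"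
  by (cases X; cases Y) simp

instantiation quat :: ab_group_add
begin

definition "0 = Quat 0 0 0 0"
definition "X + Y = Quat (scal X + scal Y) (im_i X + im_i Y) (im_j X + im_j Y) (im_k X + im_k Y)"
definition "- X = Quat (- scal X) (- im_i X) (- im_j X) (- im_k X)"
definition "X - Y = Quat (scal X - scal Y) (im_i X - im_i Y) (im_j X - im_j Y) (im_k X - im_k Y)"

instance
  by standard
    (simp_all add: quat_eq_iff zero_quat_def plus_quat_def uminus_quat_def minus_quat_def)

end

lemma quat_zero_sel [simp]: "scal 0 = 0" "im_i 0 = 0" "im_j 0 = 0" "im_k 0 = 0"
  by (simp_all add: zero_quat_def)

lemma quat_plus_sel [simp]:
  "scal (X + Y) = scal X + scal Y" "im_i (X + Y) = im_i X + im_i Y"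
  "im_j (X + Y) = im_j X + im_j Y" "im_k (X + Y) = im_k X + im_k Y"
  by (simp_all add: plus_quat_def)

lemma quat_uminus_sel [simp]:
  "scal (- X) = - scal X" "im_i (- X) = - im_i X" "im_j (- X) = - im_j X" "im_k (- X) = - im_k X"
  by (simp_all add: uminus_quat_def)

lemma quat_minus_sel [simp]:
  "scal (X - Y) = scal X - scal Y" "im_i (X - Y) = im_i X - im_i Y"
  "im_j (X - Y) = im_j X - im_j Y" "im_k (X - Y) = im_k X - im_k Y"
  by (simp_all add: minus_quat_def)

instantiation quat :: ring_1
begin

definition "1 = Quat 1 0 0 0"
definition
  "X * Y = Quat
     (scal X * scal Y - im_i X * im_i Y - im_j X * im_j Y - im_k X * im_k Y)
     (scal X * im_i Y + im_i X * scal Y + im_j X * im_k Y - im_k X * im_j Y)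
     (scal X * im_j Y - im_i X * im_k Y + im_j X * scal Y + im_k X * im_i Y)
     (scal X * im_k Y + im_i X * im_j Y - im_j X * im_i Y + im_k X * scal Y)"

instance
  by standard (simp_all add: quat_eq_iff one_quat_def times_quat_def algebra_simps)

end

lemma quat_one_sel [simp]: "scal 1 = 1" "im_i 1 = 0" "im_j 1 = 0" "im_k 1 = 0"
  by (simp_all add: one_quat_def)

lemma quat_times_sel [simp]:
  "scal (X * Y) = scal X * scal Y - im_i X * im_i Y - im_j X * im_j Y - im_k X * im_k Y"
  "im_i (X * Y) = scal X * im_i Y + im_i X * scal Y + im_j X * im_k Y - im_k X * im_j Y"
  "im_j (X * Y) = scal X * im_j Y - im_i X * im_k Y + im_j X * scal Y + im_k X * im_i Y"
  "im_k (X * Y) = scal X * im_k Y + im_i X * im_j Y - im_j X * im_i Y + im_k X * scal Y"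
  by (simp_all add: times_quat_def)

instantiation quat :: real_algebra_1
begin

definition "r *\<^sub>R X = Quat (r * scal X) (r * im_i X) (r * im_j X) (r * im_k X)"

instance
  by standard (simp_all add: quat_eq_iff scaleR_quat_def algebra_simps)

end

lemma quat_scaleR_sel [simp]:
  "scal (r *\<^sub>R X) = r * scal X" "im_i (r *\<^sub>R X) = r * im_i X"
  "im_j (r *\<^sub>R X) = r * im_j X" "im_k (r *\<^sub>R X) = r * im_k X"
  by (simp_all add: scaleR_quat_def)

lemma quat_of_real_sel [simp]:
  "scal (of_real r) = r" "im_i (of_real r) = 0" "im_j (of_real r) = 0" "im_k (of_real r) = 0"
  by (simp_all add: of_real_def)

definition vect :: "quat \<Rightarrow> quat" where
  "vect X = Quat 0 (im_i X) (im_j X) (im_k X)"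

definition qcnj :: "quat \<Rightarrow> quat" where
  "qcnj X = of_real (scal X) - vect X"

lemma vect_sel [simp]:
  "scal (vect X) = 0" "im_i (vect X) = im_i X" "im_j (vect X) = im_j X" "im_k (vect X) = im_k X"
  by (simp_all add: vect_def)

lemma qcnj_sel [simp]:
  "scal (qcnj X) = scal X" "im_i (qcnj X) = - im_i X"
  "im_j (qcnj X) = - im_j X" "im_k (qcnj X) = - im_k X"
  by (simp_all add: qcnj_def)

instantiation quat :: real_inner
begin

definition "inner X Y = scal X * scal Y + im_i X * im_i Y + im_j X * im_j Y + im_k X * im_k Y"
definition "norm X = sqrt ((scal X)\<^sup>2 + (im_i X)\<^sup>2 + (im_j X)\<^sup>2 + (im_k X)\<^sup>2)"
definition "sgn X = X /\<^sub>R norm (X :: quat)"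
definition "dist X Y = norm (X - Y :: quat)"
definition [code del]:
  "(uniformity :: (quat \<times> quat) filter) = (INF e\<in>{0 <..}. principal {(X, Y). dist X Y < e})"
definition [code del]:
  "open (U :: quat set) \<longleftrightarrow> (\<forall>X\<in>U. eventually (\<lambda>(X', Y). X' = X \<longrightarrow> Y \<in> U) uniformity)"

instance
proof
  fix X Y Z :: quat and r :: real and U :: "quat set"
  show "dist X Y = norm (X - Y)" by (rule dist_quat_def)
  show "sgn X = X /\<^sub>R norm X" by (rule sgn_quat_def)
  show "uniformity = (INF e\<in>{0 <..}. principal {(X, Y::quat). dist X Y < e})"
    by (rule uniformity_quat_def)
  show "open U \<longleftrightarrow> (\<forall>X\<in>U. eventually (\<lambda>(X', Y). X' = X \<longrightarrow> Y \<in> U) uniformity)"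
    by (rule open_quat_def)
  show "inner X Y = inner Y X"
    by (simp add: inner_quat_def mult.commute)
  show "inner (X + Y) Z = inner X Z + inner Y Z"
    by (simp add: inner_quat_def algebra_simps)
  show "inner (r *\<^sub>R X) Y = r * inner X Y"
    by (simp add: inner_quat_def algebra_simps)
  show "0 \<le> inner X X"
    by (simp add: inner_quat_def)
  have "inner X X = 0 \<longleftrightarrow>
      (scal X)\<^sup>2 + (im_i X)\<^sup>2 + ((im_j X)\<^sup>2 + (im_k X)\<^sup>2) = 0"
    by (simp add: inner_quat_def power2_eq_square add.assoc)
  also have "\<dots> \<longleftrightarrow> X = 0"
    by (subst add_nonneg_eq_0_iff) (auto simp: quat_eq_iff sum_power2_eq_zero_iff)
  finally show "inner X X = 0 \<longleftrightarrow> X = 0" .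
  show "norm X = sqrt (inner X X)"
    by (simp add: norm_quat_def inner_quat_def power2_eq_square)
qed

end

instantiation quat :: real_normed_div_algebra
begin

definition "inverse X = qcnj X /\<^sub>R (norm X)\<^sup>2"
definition "X div Y = X * inverse (Y :: quat)"

instance
proof
  fix X Y :: quat
  have n2: "(norm Z)\<^sup>2 = scal Z * scal Z + im_i Z * im_i Z + im_j Z * im_j Z + im_k Z * im_k Z"
    for Z :: quat
    by (simp add: power2_norm_eq_inner inner_quat_def)
  have l: "qcnj X * X = of_real ((norm X)\<^sup>2)" and r: "X * qcnj X = of_real ((norm X)\<^sup>2)"
    unfolding n2 by (simp_all add: quat_eq_iff)
  show "inverse X * X = 1" if "X \<noteq> 0"
    using that unfolding inverse_quat_def mult_scaleR_left l
    by (simp add: of_real_def del: of_real_power)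
  show "X * inverse X = 1" if "X \<noteq> 0"
    using that unfolding inverse_quat_def mult_scaleR_right r
    by (simp add: of_real_def del: of_real_power)
  show "X div Y = X * inverse Y" by (rule divide_quat_def)
  show "inverse (0 :: quat) = 0"
    by (simp add: inverse_quat_def)
  have "(norm (X * Y))\<^sup>2 = (norm X * norm Y)\<^sup>2"
    unfolding power_mult_distrib n2 quat_times_sel by (simp add: algebra_simps)
  then show "norm (X * Y) = norm X * norm Y"
    by (simp add: power2_eq_iff_nonneg)
qed

end

definition quat_i :: quat (\<open>\<i>\<^sub>q\<close>) where "\<i>\<^sub>q = Quat 0 1 0 0"
definition quat_j :: quat (\<open>\<j>\<^sub>q\<close>) where "\<j>\<^sub>q = Quat 0 0 1 0"
definition quat_k :: quat (\<open>\<k>\<^sub>q\<close>) where "\<k>\<^sub>q = Quat 0 0 0 1"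

instantiation quat :: euclidean_space
begin

definition "Basis = {1, \<i>\<^sub>q, \<j>\<^sub>q, \<k>\<^sub>q}"

instance
proof
  fix X Y :: quat
  note units = quat_i_def quat_j_def quat_k_def
  show "(Basis :: quat set) \<noteq> {}" and "finite (Basis :: quat set)"
    by (simp_all add: Basis_quat_def)
  show "inner X Y = (if X = Y then 1 else 0)" if "X \<in> Basis" "Y \<in> Basis"
    using that unfolding Basis_quat_def
    by (elim insertE emptyE; simp add: inner_quat_def quat_eq_iff units)
  have "(\<forall>U\<in>Basis. inner X U = 0) \<longleftrightarrow>
      scal X = 0 \<and> im_i X = 0 \<and> im_j X = 0 \<and> im_k X = 0"
    unfolding Basis_quat_def by (simp add: inner_quat_def units)
  also have "\<dots> \<longleftrightarrow> X = 0"
    by (simp add: quat_eq_iff)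
  finally show "(\<forall>U\<in>Basis. inner X U = 0) \<longleftrightarrow> X = 0" .
qed

end

lemma quat_DIM: "DIM(quat) = 4"
  by (simp add: Basis_quat_def quat_eq_iff quat_i_def quat_j_def quat_k_def)

lemma quat_units:
  "\<i>\<^sub>q * \<i>\<^sub>q = -1" "\<j>\<^sub>q * \<j>\<^sub>q = -1" "\<k>\<^sub>q * \<k>\<^sub>q = -1" "\<i>\<^sub>q * \<j>\<^sub>q * \<k>\<^sub>q = -1"
  "\<i>\<^sub>q * \<j>\<^sub>q = \<k>\<^sub>q" "\<j>\<^sub>q * \<k>\<^sub>q = \<i>\<^sub>q" "\<k>\<^sub>q * \<i>\<^sub>q = \<j>\<^sub>q"
  by (simp_all add: quat_eq_iff quat_i_def quat_j_def quat_k_def)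

lemma quat_expand:
  "X = of_real (scal X) + im_i X *\<^sub>R \<i>\<^sub>q + im_j X *\<^sub>R \<j>\<^sub>q + im_k X *\<^sub>R \<k>\<^sub>q"
  by (simp add: quat_eq_iff quat_i_def quat_j_def quat_k_def)

lemma quat_scal_vect: "X = of_real (scal X) + vect X"
  by (simp add: quat_eq_iff)

lemma mult_qcnj: "X * qcnj X = of_real ((norm X)\<^sup>2)" "qcnj X * X = of_real ((norm X)\<^sup>2)"
  by (simp_all add: quat_eq_iff power2_norm_eq_inner inner_quat_def)

lemma inner_quat_scal: "inner X Y = scal (X * qcnj Y)"
  by (simp add: inner_quat_def)

lemma quat_Reals_iff: "X \<in> \<real> \<longleftrightarrow> vect X = 0"
proof
  assume "X \<in> \<real>"
  then show "vect X = 0" by (auto simp: Reals_def quat_eq_iff)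
next
  assume "vect X = 0"
  then have "X = of_real (scal X)" using quat_scal_vect [of X] by simp
  then show "X \<in> \<real>" by (metis Reals_of_real)
qed


section \<open>The planes and circles attached to pure vector quaternions\<close>

text \<open>For a non-zero pure vector quaternion, \<^term>\<open>sgn x\<close> is the normalisation \<open>x / |x|\<close>.\<close>

definition quat_complex :: "quat \<Rightarrow> quat set" where
  "quat_complex x = {of_real a + sgn x * of_real b | a b. True}"

text \<open>The following is meaningful only for non-zero pure vector quaternions \<open>p\<close> and \<open>s\<close>.\<close>

definition quat_plane :: "quat \<Rightarrow> quat \<Rightarrow> quat set" where
  "quat_plane p s =
     (if sgn s \<noteq> - sgn p
      then (\<lambda>z. ((sgn p + sgn s) /\<^sub>R norm (sgn p + sgn s)) * z) ` quat_complex p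
      else {y. scal y = 0 \<and> orthogonal y (sgn p)})"

definition quat_circle :: "quat \<Rightarrow> quat \<Rightarrow> quat set" where
  "quat_circle p s =
     (if s = 0 then {0} else quat_plane p s \<inter> sphere 0 (sqrt (norm s / norm p)))"

end

theory Submission
  imports Defs
begin

text \<open>
  The equation \<open>X P X\<^sup>* + X Q + R X\<^sup>* = S\<close> is a quadratic equation with two different linear terms.
  A translation makes them conjugate to each other: for \<open>X = Z - A\<close> the new
  linear coefficients are \<open>Q - P A\<^sup>*\<close> and \<open>R - A P\<close>, and requiring that they be conjugate is the
  linear equation \<open>A (P - P\<^sup>*) = R - Q\<^sup>*\<close>, solvable since \<open>P\<close> is not real. What remains is
  \<open>Z P Z\<^sup>* + Z T\<^sup>* + T Z\<^sup>* = W\<close> with \<open>T\<close>, \<open>W\<close> the quaternions called \<open>Rt\<close>, \<open>St\<close> in the theorem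
  (lemma \<open>completed_equation\<close>).

  Now \<open>Z T\<^sup>* + T Z\<^sup>* = 2 \<langle>Z, T\<rangle>\<close> is real, so the equation splits into two independent conditions
  (lemma \<open>completed_equation_scal_vect\<close>): the vector part \<open>Z p Z\<^sup>* = s\<close>, where \<open>p\<close> and \<open>s\<close> are the
  vector parts of \<open>P\<close> and \<open>W\<close>, and the scalar part \<open>p\<^sub>0 |Z|\<^sup>2 + 2 \<langle>Z, T\<rangle> = s\<^sub>0\<close>.

  The vector part describes the circle, which is the point \<open>0\<close> for \<open>s = 0\<close>
  (lemma \<open>quat_circle_iff\<close>). Taking norms gives \<open>|Z|\<^sup>2 = |s| / |p|\<close>; when
  \<open>s\<close> is not zero, what is left is that conjugation by \<open>Z\<close> rotates the unit vector \<open>n\<close> of \<open>p\<close> to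
  the unit vector \<open>m\<close> of \<open>s\<close>, that is, the linear condition \<open>Z n = m Z\<close>. Its solutions form a
  plane: from one solution \<open>Y\<close> the others arise by right multiplication with the centraliser
  \<open>\<real> + \<real> n\<close> of \<open>n\<close>. This description covers \<open>m = - n\<close> and \<open>m \<noteq> - n\<close> alike
  (lemma \<open>quat_plane_eq_intertwiners\<close>).

  On the circle the norm is constant, so the scalar part prescribes the value of \<open>\<langle>Z, T\<rangle>\<close>. If \<open>T\<close> is orthogonal to the plane of the circle, that product vanishes
  on the whole circle, so the condition holds at all of its points or at none; otherwise the
  condition cuts out a line in the plane, which meets the circle in
  at most two points.
\<close>

section \<open>Conjugation and unit vectors\<close>

lemma qcnj_qcnj: "qcnj (qcnj X) = X"
  by (simp add: quat_eq_iff)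

lemma qcnj_diff: "qcnj (X - Y) = qcnj X - qcnj Y"
  by (simp add: quat_eq_iff)

lemma qcnj_mult: "qcnj (X * Y) = qcnj Y * qcnj X"
  by (simp add: quat_eq_iff algebra_simps)

lemma norm_qcnj: "norm (qcnj X) = norm X"
  by (simp add: norm_quat_def)

text \<open>A pure vector satisfies \<open>n\<^sup>* = - n\<close>, so its square is \<open>- |n|\<^sup>2\<close>. Because of this lemma \<open>\<real> + \<real> n\<close> is
  a copy of the complex numbers, and right multiplication by \<open>n\<close> is a quarter turn.\<close>

lemma pure_unit_square:
  assumes "scal n = 0" "norm n = 1"
  shows "n * n = -1"
proof -
  have "qcnj n = - n"
    using assms(1) by (simp add: quat_eq_iff)
  then show ?thesis
    using mult_qcnj(1)[of n] assms(2) by (simp add: minus_equation_iff)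
qed

lemma scal_sgn: "scal (sgn X) = scal X / norm X"
  by (simp add: sgn_quat_def divide_inverse mult.commute)

section \<open>Completing the square\<close>

text \<open>The translation by \<open>A\<close> produces the linear coefficients \<open>R - A P\<close> and \<open>Q - P A\<^sup>*\<close> and the constant
  term \<open>S - A P A\<^sup>* + A Q + R A\<^sup>*\<close>. These are evaluated as \<open>Rt\<close>, its conjugate, and \<open>St\<close>, using
  that \<open>D = P - P\<^sup>*\<close> is a pure vector commuting with \<open>P\<close> and \<open>P\<^sup>*\<close>, so that its inverse \<open>E\<close>
  satisfies \<open>E\<^sup>* = - E\<close> and \<open>E\<^sup>2 = - 1 / |D|\<^sup>2\<close>.\<close>

lemma completed_equation:
  fixes P Q R S Z :: quat
  assumes D: "P - qcnj P \<noteq> 0"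
  defines "A \<equiv> (R - qcnj Q) * inverse (P - qcnj P)"
  defines "Rt \<equiv> (qcnj Q * P - R * qcnj P) * inverse (P - qcnj P)"
  defines "St \<equiv> S
      + (qcnj Q * P * qcnj R + R * qcnj P * Q) /\<^sub>R (norm (P - qcnj P))\<^sup>2
      + (R * (qcnj P - P) * Q) /\<^sub>R (norm (P - qcnj P))\<^sup>2
      - (qcnj Q * qcnj P * Q) /\<^sub>R (norm (P - qcnj P))\<^sup>2
      - (R * qcnj P * qcnj R) /\<^sub>R (norm (P - qcnj P))\<^sup>2"
  shows "(Z - A) * P * qcnj (Z - A) + (Z - A) * Q + R * qcnj (Z - A) = S
    \<longleftrightarrow> Z * P * qcnj Z + Z * qcnj Rt + Rt * qcnj Z = St"
proof -
  define D where "D = P - qcnj P"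
  define E where "E = inverse D"
  define a where "a = inverse ((norm D)\<^sup>2)"
  have DE: "D * E = 1" and ED: "E * D = 1"
    using assms(1) by (simp_all add: D_def E_def)
  have "qcnj D = - D"
    by (simp add: D_def quat_eq_iff)
  then have E: "E = - (a *\<^sub>R D)"
    by (simp add: E_def a_def inverse_quat_def)
  have EE: "E * E = - of_real a"
    using ED E by (metis mult_minus_right mult_scaleR_right of_real_def)
  have Ecnj: "qcnj E = - E"
    by (simp add: E D_def quat_eq_iff)
  have PE: "P * E = E * P"
    by (simp add: E D_def quat_eq_iff)
  have A: "A = (R - qcnj Q) * E" and Rt: "Rt = (qcnj Q * P - R * qcnj P) * E"
    by (simp_all add: A_def Rt_def E_def D_def)
  have Acnj: "qcnj A = E * (Q - qcnj R)"
    by (simp add: A qcnj_mult qcnj_diff qcnj_qcnj Ecnj algebra_simps)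
  \<comment> \<open>Inserting \<open>D E = 1\<close> next to the isolated coefficient puts both terms over the denominator \<open>D\<close>.\<close>
  have "R - A * P = R * (D * E) - (R - qcnj Q) * P * E"
    by (simp add: DE A mult.assoc PE)
  also have "\<dots> = Rt"
    by (simp add: Rt D_def algebra_simps)
  finally have c1: "R - A * P = Rt" .
  have "qcnj P * E = E * qcnj P"
    by (simp add: E D_def quat_eq_iff)
  then have "qcnj Q - A * qcnj P = qcnj Q * (D * E) - (R - qcnj Q) * qcnj P * E"
    by (simp add: DE A mult.assoc)
  also have "\<dots> = Rt"
    by (simp add: Rt D_def algebra_simps)
  finally have "qcnj Q - A * qcnj P = Rt" .
  from arg_cong[OF this, of qcnj] have c2: "Q - P * qcnj A = qcnj Rt"
    by (simp add: qcnj_mult qcnj_diff qcnj_qcnj)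
  have "A * P * qcnj A = (R - qcnj Q) * (E * E) * P * (Q - qcnj R)"
    unfolding Acnj unfolding A by (simp add: mult.assoc) (simp add: mult.assoc[symmetric] PE)
  then have t1: "A * P * qcnj A = a *\<^sub>R ((R - qcnj Q) * P * (qcnj R - Q))"
    by (simp add: EE of_real_def algebra_simps)
  have c3: "S - A * P * qcnj A + A * Q + R * qcnj A = St"
    unfolding t1 unfolding Acnj unfolding A St_def E D_def[symmetric] a_def[symmetric]
    by (simp add: D_def algebra_simps scaleR_2[symmetric])
  have "(Z - A) * P * qcnj (Z - A) + (Z - A) * Q + R * qcnj (Z - A) - S
      = Z * P * qcnj Z + Z * (Q - P * qcnj A) + (R - A * P) * qcnj Z
        - (S - A * P * qcnj A + A * Q + R * qcnj A)"
    by (simp add: qcnj_diff algebra_simps)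
  then show ?thesis
    unfolding c1 c2 c3 by (metis eq_iff_diff_eq_0)
qed

text \<open>Both \<open>Z T\<^sup>* + T Z\<^sup>*\<close> and the contribution \<open>scal P * |Z|\<^sup>2\<close> of the scalar part of \<open>P\<close> are real,
  whereas \<open>Z p Z\<^sup>*\<close> is a pure vector for \<open>p = vect P\<close>.\<close>

lemma completed_equation_scal_vect:
  "Z * P * qcnj Z + Z * qcnj T + T * qcnj Z = W \<longleftrightarrow>
     Z * vect P * qcnj Z = vect W \<and> scal P * (norm Z)\<^sup>2 + 2 * inner Z T = scal W"
  by (auto simp: quat_eq_iff inner_quat_def power2_norm_eq_inner algebra_simps)

section \<open>The plane of quaternions rotating one direction to another\<close>

text \<open>Two quaternions commute only if the cross product of their vector parts vanishes, so the
  vector part of \<open>W\<close> has to be a multiple of \<open>n\<close>.\<close>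

lemma commutes_pure_unit_iff:
  assumes "scal n = 0" "norm n = 1"
  shows "W * n = n * W \<longleftrightarrow> (\<exists>a b. W = of_real a + b *\<^sub>R n)"
proof
  assume comm: "W * n = n * W"
  have n: "(im_i n)\<^sup>2 + (im_j n)\<^sup>2 + (im_k n)\<^sup>2 = 1"
    using assms by (simp add: norm_quat_def)
  have "im_j W * im_k n = im_k W * im_j n" "im_k W * im_i n = im_i W * im_k n"
    "im_i W * im_j n = im_j W * im_i n"
    using comm assms(1) by (simp_all add: quat_eq_iff mult.commute)
  then have "W = of_real (scal W) + inner W n *\<^sub>R n"
    using n assms(1) unfolding quat_eq_iff inner_quat_def
    by simp (intro conjI; algebra)
  then show "\<exists>a b. W = of_real a + b *\<^sub>R n" by blast
next
  assume "\<exists>a b. W = of_real a + b *\<^sub>R n"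
  then show "W * n = n * W"
    by (auto simp: quat_eq_iff)
qed

text \<open>For unit vectors \<open>n\<close> and \<open>m\<close>, a nonzero \<open>Z\<close> belongs to this set if and only if the rotation
  \<open>v \<mapsto> Z * v * inverse Z\<close> maps \<open>n\<close> to \<open>m\<close>. Written without the inverse, the condition is linear in \<open>Z\<close>.\<close>

definition intertwiners :: "quat \<Rightarrow> quat \<Rightarrow> quat set" where
  "intertwiners n m = {Z. Z * n = m * Z}"

lemma subspace_intertwiners: "subspace (intertwiners n m)"
  by (auto simp: intertwiners_def subspace_def algebra_simps)

lemma intertwiners_mult_right:
  "Y \<in> intertwiners n m \<Longrightarrow> Y * n \<in> intertwiners n m"
  unfolding intertwiners_def by simp (metis mult.assoc)

text \<open>Two rotations that map \<open>n\<close> to \<open>m\<close> differ by a rotation fixing \<open>n\<close>: if \<open>Y\<close> and \<open>Z\<close> are intertwiners,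
  then \<open>inverse Y * Z\<close> commutes with \<open>n\<close>.\<close>

lemma intertwiners_iff:
  assumes n: "scal n = 0" "norm n = 1"
    and Y: "Y \<in> intertwiners n m" "Y \<noteq> 0"
  shows "Z \<in> intertwiners n m \<longleftrightarrow> (\<exists>a b. Z = a *\<^sub>R Y + b *\<^sub>R (Y * n))"
proof -
  define W where "W = inverse Y * Z"
  have Z: "Z = Y * W"
    using Y(2) by (simp add: W_def mult.assoc[symmetric])
  have "Z * n = m * Z \<longleftrightarrow> Y * (W * n) = Y * (n * W)"
    using Y(1) by (simp add: Z intertwiners_def mult.assoc[symmetric])
  also have "\<dots> \<longleftrightarrow> W * n = n * W"
    using Y(2) by simp
  also have "\<dots> \<longleftrightarrow> (\<exists>a b. W = of_real a + b *\<^sub>R n)"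
    by (rule commutes_pure_unit_iff[OF n])
  also have "\<dots> \<longleftrightarrow> (\<exists>a b. Y * W = Y * (of_real a + b *\<^sub>R n))"
    using Y(2) by simp
  also have "\<dots> \<longleftrightarrow> (\<exists>a b. Z = a *\<^sub>R Y + b *\<^sub>R (Y * n))"
    by (simp add: Z distrib_left of_real_def)
  finally show ?thesis by (simp add: intertwiners_def)
qed

text \<open>Averaging an arbitrary \<open>V\<close> gives the intertwiner \<open>V n + m V\<close>, because \<open>n\<^sup>2 = m\<^sup>2 = - 1\<close>. If it vanished
  for all \<open>V\<close>, then \<open>V = 1\<close> would give \<open>m = - n\<close>, and \<open>n\<close> would be central, hence real.\<close>

lemma intertwiners_nonzero:
  assumes n: "scal n = 0" "norm n = 1" and m: "scal m = 0" "norm m = 1"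
  obtains Y where "Y \<in> intertwiners n m" "Y \<noteq> 0"
proof -
  have mem: "V * n + m * V \<in> intertwiners n m" for V
    using pure_unit_square[OF n] pure_unit_square[OF m]
    by (simp add: intertwiners_def distrib_left distrib_right mult.assoc)
      (simp add: mult.assoc[symmetric])
  have "\<exists>V. V * n + m * V \<noteq> 0"
  proof (rule ccontr)
    assume "\<not> ?thesis"
    then have all: "V * n + m * V = 0" for V by blast
    have "m = - n"
      using all[of 1] by (simp add: eq_neg_iff_add_eq_0 add.commute)
    then have "n = 0"
      using all[of "\<i>\<^sub>q"] all[of "\<j>\<^sub>q"] n(1)
      by (simp add: quat_eq_iff quat_i_def quat_j_def)
    then show False using n(2) by simp
  qed
  then show thesis using mem that by blast
qed

lemma inner_mult_right_pure: "scal n = 0 \<Longrightarrow> inner Y (Y * n) = 0"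
  by (simp add: inner_quat_def algebra_simps)

text \<open>An intertwiner \<open>Y\<close> and \<open>Y n\<close> form an orthogonal basis.\<close>

lemma dim_intertwiners:
  assumes n: "scal n = 0" "norm n = 1" and m: "scal m = 0" "norm m = 1"
  shows "dim (intertwiners n m) = 2"
proof -
  obtain Y where Y: "Y \<in> intertwiners n m" "Y \<noteq> 0"
    using intertwiners_nonzero[OF n m] .
  have orth: "inner Y (Y * n) = 0"
    by (rule inner_mult_right_pure[OF n(1)])
  have "n \<noteq> 0" using n(2) by auto
  then have ne: "Y * n \<noteq> 0" "Y \<noteq> Y * n"
    using Y(2) orth by auto
  have "pairwise orthogonal {Y, Y * n}"
    using orth by (auto simp: pairwise_def orthogonal_def inner_commute)
  then have ind: "independent {Y, Y * n}"
    by (rule pairwise_orthogonal_independent) (use Y(2) ne in auto)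
  have "intertwiners n m = span {Y, Y * n}"
  proof (rule set_eqI)
    fix Z
    have "Z \<in> span {Y, Y * n} \<longleftrightarrow> (\<exists>a b. Z - a *\<^sub>R Y = b *\<^sub>R (Y * n))"
      by (auto simp: span_insert span_singleton)
    then show "Z \<in> intertwiners n m \<longleftrightarrow> Z \<in> span {Y, Y * n}"
      by (simp add: intertwiners_iff[OF n Y] diff_eq_eq add.commute)
  qed
  then show ?thesis
    using dim_span_eq_card_independent[OF ind] ne by simp
qed

text \<open>For \<open>m \<noteq> - n\<close> the vector \<open>n + m\<close> is an intertwiner (geometrically, the half turn about the
  bisector of \<open>n\<close> and \<open>m\<close> exchanges them) and the plane is its orbit under \<open>\<real> + \<real> n\<close>. For \<open>m = - n\<close>
  the condition becomes \<open>y n + n y = 0\<close>, and this anticommutator equals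
  \<open>2 (scal y * n - \<langle>y, n\<rangle>)\<close>, a difference of a pure vector and a real number, which must both vanish.\<close>

lemma quat_plane_eq_intertwiners:
  assumes p: "scal p = 0" "p \<noteq> 0" and s: "scal s = 0" "s \<noteq> 0"
  shows "quat_plane p s = intertwiners (sgn p) (sgn s)"
proof -
  define n where "n = sgn p"
  define m where "m = sgn s"
  have n: "scal n = 0" "norm n = 1" and m: "scal m = 0" "norm m = 1"
    using assms by (simp_all add: n_def m_def scal_sgn norm_sgn)
  show ?thesis
  proof (cases "m = - n")
    case True
    have "y * n = m * y \<longleftrightarrow> scal y = 0 \<and> orthogonal y n" for y
    proof -
      have "y * n - m * y = 2 *\<^sub>R (scal y *\<^sub>R n - of_real (inner y n))"
        using n(1) by (simp add: True quat_eq_iff inner_quat_def)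
      then have "y * n = m * y \<longleftrightarrow> scal y *\<^sub>R n = of_real (inner y n)"
        by (metis eq_iff_diff_eq_0 scaleR_eq_0_iff zero_neq_numeral)
      also have "\<dots> \<longleftrightarrow> scal y = 0 \<and> inner y n = 0"
      proof
        assume e: "scal y *\<^sub>R n = of_real (inner y n)"
        have "inner y n = 0"
          using arg_cong[OF e, of scal] n(1) by simp
        moreover from this have "scal y = 0"
          using e n(2) by auto
        ultimately show "scal y = 0 \<and> inner y n = 0" by simp
      qed simp
      finally show ?thesis by (simp add: orthogonal_def)
    qed
    then show ?thesis
      using True by (auto simp: quat_plane_def intertwiners_def n_def m_def)
  next
    case False
    define u where "u = (n + m) /\<^sub>R norm (n + m)"
    have "n + m \<noteq> 0"
      using False by (metis add.commute eq_neg_iff_add_eq_0)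
    then have u0: "u \<noteq> 0"
      by (simp add: u_def)
    have "(n + m) * n = m * (n + m)"
      using pure_unit_square[OF n] pure_unit_square[OF m] by (simp add: algebra_simps)
    then have u: "u \<in> intertwiners n m"
      by (simp add: u_def intertwiners_def)
    have "quat_plane p s = (\<lambda>z. u * z) ` quat_complex p"
      using False by (simp add: quat_plane_def u_def n_def m_def)
    also have "\<dots> = {u * (of_real a + n * of_real b) | a b. True}"
      by (auto simp: quat_complex_def n_def)
    also have "\<dots> = {a *\<^sub>R u + b *\<^sub>R (u * n) | a b. True}"
      by (simp add: distrib_left of_real_def)
    also have "\<dots> = intertwiners n m"
      using intertwiners_iff[OF n u u0] by auto
    finally show ?thesis by (simp add: n_def m_def)
  qed
qed

section \<open>The circle, and its intersection with a line\<close>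

text \<open>Multiplying \<open>Z p Z\<^sup>* = s\<close> by \<open>Z\<close> on the right turns it into \<open>|Z|\<^sup>2 Z p = s Z\<close>. Taking norms in the
  original equation gives \<open>|Z|\<^sup>2 |p| = |s|\<close>, so if \<open>s \<noteq> 0\<close> a factor \<open>|s|\<close> cancels and only the unit vectors of
  \<open>p\<close> and \<open>s\<close> remain.\<close>

lemma quat_circle_iff:
  assumes p: "scal p = 0" "p \<noteq> 0" and s: "scal s = 0"
  shows "Z \<in> quat_circle p s \<longleftrightarrow> Z * p * qcnj Z = s"
proof (cases "s = 0")
  case True
  have "Z * p * qcnj Z = 0 \<longleftrightarrow> Z = 0"
    using p(2) norm_qcnj[of Z] by auto
  then show ?thesis by (simp add: True quat_circle_def)
next
  case False
  have pn: "p = norm p *\<^sub>R sgn p" and sn: "s = norm s *\<^sub>R sgn s"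
    using p(2) False by (simp_all add: sgn_quat_def)
  have "Z \<in> quat_circle p s \<longleftrightarrow> Z * sgn p = sgn s * Z \<and> norm Z = sqrt (norm s / norm p)"
    using False quat_plane_eq_intertwiners[OF p s False]
    by (simp add: quat_circle_def intertwiners_def)
  also have "norm Z = sqrt (norm s / norm p) \<longleftrightarrow> (norm Z)\<^sup>2 * norm p = norm s"
  proof -
    have "norm Z = sqrt (norm s / norm p) \<longleftrightarrow> (norm Z)\<^sup>2 = norm s / norm p"
      by (metis norm_ge_zero real_sqrt_abs abs_norm_cancel real_sqrt_pow2 divide_nonneg_nonneg)
    then show ?thesis using p(2) by (simp add: field_simps)
  qed
  also have "Z * sgn p = sgn s * Z \<and> (norm Z)\<^sup>2 * norm p = norm s \<longleftrightarrow> Z * p * qcnj Z = s"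
  proof
    assume h: "Z * sgn p = sgn s * Z \<and> (norm Z)\<^sup>2 * norm p = norm s"
    have "Z * p * qcnj Z = norm p *\<^sub>R (Z * sgn p * qcnj Z)"
      by (subst pn) simp
    also have "\<dots> = norm p *\<^sub>R (sgn s * (Z * qcnj Z))"
      using h by (simp add: mult.assoc)
    also have "\<dots> = ((norm Z)\<^sup>2 * norm p) *\<^sub>R sgn s"
      by (simp add: mult_qcnj of_real_def mult.commute del: of_real_power)
    finally show "Z * p * qcnj Z = s" using h sn by simp
  next
    assume h: "Z * p * qcnj Z = s"
    have len: "(norm Z)\<^sup>2 * norm p = norm s"
      unfolding h[symmetric] by (simp add: norm_mult norm_qcnj power2_eq_square)
    have "norm s *\<^sub>R (sgn s * Z) = s * Z"
      by (subst (3) sn) simp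
    also have "\<dots> = Z * p * (qcnj Z * Z)"
      by (simp add: h[symmetric] mult.assoc)
    also have "\<dots> = norm s *\<^sub>R (Z * sgn p)"
      by (subst pn) (simp add: len[symmetric] mult_qcnj of_real_def mult.commute del: of_real_power)
    finally show "Z * sgn p = sgn s * Z \<and> (norm Z)\<^sup>2 * norm p = norm s"
      using len False by simp
  qed
  finally show ?thesis .
qed

text \<open>In the coordinates \<open>x\<close>, \<open>y\<close> adapted to the normal \<open>R\<close>, the hyperplane fixes \<open>x\<close> and the sphere then
  fixes \<open>y\<close> up to sign.\<close>

lemma circle_meets_line_card_le_2:
  fixes e f R :: "'a::real_inner"
  assumes "norm e = 1" "norm f = 1" "inner e f = 0" "inner R f = 0" "inner R e \<noteq> 0"
    and L: "\<And>Z. Z \<in> L \<Longrightarrow>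
      (\<exists>x y. Z = x *\<^sub>R e + y *\<^sub>R f) \<and> norm Z = r \<and> inner Z R = c"
  shows "finite L \<and> card L \<le> 2"
proof -
  define x where "x = c / inner R e"
  define y where "y = sqrt (r\<^sup>2 - x\<^sup>2)"
  have "L \<subseteq> {x *\<^sub>R e + y *\<^sub>R f, x *\<^sub>R e + (- y) *\<^sub>R f}" (is "_ \<subseteq> ?T")
  proof
    fix Z assume "Z \<in> L"
    then obtain a b where Z: "Z = a *\<^sub>R e + b *\<^sub>R f" "norm Z = r" "inner Z R = c"
      using L by blast
    have "a * inner R e = c"
      using Z(3) assms(4) unfolding Z(1) inner_commute[of _ R] by (simp add: inner_add_right)
    then have a: "a = x"
      using assms(5) by (simp add: x_def nonzero_eq_divide_eq)
    have "inner e e = 1" "inner f f = 1" "inner f e = 0"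
      using assms(1-3) by (simp_all add: norm_eq_1 inner_commute)
    then have "r\<^sup>2 = a\<^sup>2 + b\<^sup>2"
      using Z(1) assms(3) unfolding Z(2)[symmetric] power2_norm_eq_inner
      by (simp add: inner_add_left inner_add_right power2_eq_square)
    then have "b = y \<or> b = - y"
      unfolding y_def a by auto
    then show "Z \<in> ?T" using Z(1) a by auto
  qed
  moreover have "finite ?T" "card ?T \<le> 2"
    by (simp_all add: card_insert_if)
  ultimately show ?thesis
    by (meson card_mono finite_subset le_trans)
qed

text \<open>The plane contains a unit vector \<open>f\<close> orthogonal to \<open>T\<close>, by dimension. Right multiplication by \<open>n\<close>
  is a quarter turn of the plane, so \<open>f\<close> and \<open>f n\<close> form an orthonormal basis, and \<open>T\<close> cannot be
  orthogonal to \<open>f n\<close> as well. These are the coordinates in which the line has a fixed abscissa.\<close>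

lemma intertwiners_adapted_vector:
  assumes n: "scal n = 0" "norm n = 1" and m: "scal m = 0" "norm m = 1"
    and "\<not> (\<forall>Y \<in> intertwiners n m. orthogonal T Y)"
  obtains f where "f \<in> intertwiners n m" "norm f = 1" "inner T f = 0" "inner T (f * n) \<noteq> 0"
proof -
  obtain Y where Y: "Y \<in> intertwiners n m" "inner T Y \<noteq> 0"
    using assms(5) by (auto simp: orthogonal_def)
  \<comment> \<open>The combination of the basis \<open>Y\<close>, \<open>Y n\<close> whose inner product with \<open>T\<close> cancels.\<close>
  define g where "g = inner T (Y * n) *\<^sub>R Y - inner T Y *\<^sub>R (Y * n)"
  have g: "g \<in> intertwiners n m"
    unfolding g_def
    by (intro subspace_diff subspace_scale subspace_intertwiners intertwiners_mult_right Y(1))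
  have "g * n = inner T (Y * n) *\<^sub>R (Y * n) + inner T Y *\<^sub>R Y"
    using pure_unit_square[OF n] by (simp add: g_def left_diff_distrib mult.assoc)
  then have Tgn: "inner T (g * n) = (inner T (Y * n))\<^sup>2 + (inner T Y)\<^sup>2"
    by (simp add: inner_add_right power2_eq_square)
  then have pos: "inner T (g * n) \<noteq> 0"
    using Y(2) by (simp add: sum_power2_eq_zero_iff)
  then have g0: "g \<noteq> 0" by auto
  have Tg: "inner T g = 0"
    by (simp add: g_def inner_diff_right)
  show thesis
  proof (rule that[of "sgn g"])
    show "sgn g \<in> intertwiners n m"
      unfolding sgn_quat_def by (intro subspace_scale subspace_intertwiners g)
  qed (use g0 Tg pos in \<open>simp_all add: norm_sgn\<close>, simp_all add: sgn_quat_def)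
qed

section \<open>The solution set\<close>

theorem theorem3:
  fixes P Q R S :: quat
  assumes "P \<notin> \<real>"
  assumes "p0 = scal P" and "p = vect P"
  assumes "Rt = (qcnj Q * P - R * qcnj P) * inverse (P - qcnj P)"
  assumes "St = S
      + (qcnj Q * P * qcnj R + R * qcnj P * Q) /\<^sub>R (norm (P - qcnj P))\<^sup>2
      + (R * (qcnj P - P) * Q) /\<^sub>R (norm (P - qcnj P))\<^sup>2
      - (qcnj Q * qcnj P * Q) /\<^sub>R (norm (P - qcnj P))\<^sup>2
      - (R * qcnj P * qcnj R) /\<^sub>R (norm (P - qcnj P))\<^sup>2"
  assumes "s0 = scal St" and "s = vect St"
  assumes "A = (R - qcnj Q) * inverse (P - qcnj P)"
  assumes "Sol = {X. X * P * qcnj X + X * Q + R * qcnj X = S}"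
  assumes "H = {Z. inner Z Rt = (s0 * norm p - p0 * norm s) / (2 * norm p)}"
  shows "Sol = (\<lambda>Z. Z - A) ` (quat_circle p s \<inter> H)
    \<and> (St = 0 \<longrightarrow> Sol = {- A})
    \<and> (St \<in> \<real> \<and> St \<noteq> 0 \<longrightarrow> Sol = {})
    \<and> (St \<notin> \<real> \<longrightarrow>
        ((\<forall>Y \<in> quat_plane p s. orthogonal Rt Y) \<longrightarrow>
          Sol = (if s0 * norm p = p0 * norm s then (\<lambda>Z. Z - A) ` quat_circle p s else {}))
      \<and> (\<not> (\<forall>Y \<in> quat_plane p s. orthogonal Rt Y) \<longrightarrow>
          affine (quat_plane p s \<inter> H) \<and> aff_dim (quat_plane p s \<inter> H) = 1
          \<and> Sol = (\<lambda>Z. Z - A) ` (quat_circle p s \<inter> (quat_plane p s \<inter> H))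
          \<and> finite Sol \<and> card Sol \<in> {2, 1, 0}))"
proof -
  have D: "P - qcnj P \<noteq> 0"
    using assms(1) by (auto simp: quat_Reals_iff quat_eq_iff)
  have p: "scal p = 0" "p \<noteq> 0" and s: "scal s = 0"
    using assms(1,3,7) by (auto simp: quat_Reals_iff)
  define C where "C = quat_circle p s"
  \<comment> \<open>On the circle \<open>|Z|\<^sup>2\<close> has the constant value \<open>|s| / |p|\<close>, which makes the scalar part affine in \<open>Z\<close>.\<close>
  have hyper: "p0 * (norm Z)\<^sup>2 + 2 * inner Z Rt = s0 \<longleftrightarrow> Z \<in> H" if "Z \<in> C" for Z
  proof -
    have "Z * p * qcnj Z = s"
      using that by (simp add: C_def quat_circle_iff[OF p s])
    then have "(norm Z)\<^sup>2 * norm p = norm s"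
      by (auto simp: norm_mult norm_qcnj power2_eq_square)
    then have len: "(norm Z)\<^sup>2 = norm s / norm p"
      using p(2) by (simp add: field_simps)
    show ?thesis
      unfolding assms(10) len using p(2) by (auto simp: field_simps)
  qed
  have shifted: "Z - A \<in> Sol \<longleftrightarrow> Z \<in> C \<inter> H" for Z
  proof -
    have "Z - A \<in> Sol \<longleftrightarrow> Z * P * qcnj Z + Z * qcnj Rt + Rt * qcnj Z = St"
      unfolding assms(4,5,8,9) using completed_equation[OF D, of Z R Q S] by simp
    also have "\<dots> \<longleftrightarrow> Z \<in> C \<and> p0 * (norm Z)\<^sup>2 + 2 * inner Z Rt = s0"
      by (simp add: completed_equation_scal_vect assms(2,3,6,7) C_def
          quat_circle_iff[OF p s, unfolded assms(3,7)])
    finally show ?thesis using hyper by blast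
  qed
  have Sol: "Sol = (\<lambda>Z. Z - A) ` (C \<inter> H)"
  proof (rule set_eqI)
    fix X
    have "X \<in> Sol \<longleftrightarrow> X + A \<in> C \<inter> H"
      using shifted[of "X + A"] by simp
    then show "X \<in> Sol \<longleftrightarrow> X \<in> (\<lambda>Z. Z - A) ` (C \<inter> H)"
      by (auto intro: rev_image_eqI)
  qed
  have zero: "Sol = {- A}" if "St = 0"
  proof -
    have "s = 0" "s0 = 0"
      using that assms(6,7) by (simp_all add: quat_eq_iff)
    then have "C = {0}" "0 \<in> H"
      using assms(10) by (simp_all add: C_def quat_circle_def)
    then show ?thesis by (simp add: Sol)
  qed
  have real: "Sol = {}" if "St \<in> \<real>" "St \<noteq> 0"
  proof -
    have s0: "s = 0" using that(1) assms(7) by (simp add: quat_Reals_iff)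
    moreover from this have "s0 \<noteq> 0"
      using that(2) quat_scal_vect[of St] assms(6,7) by auto
    ultimately have "C = {0}" "0 \<notin> H"
      using p(2) assms(10) by (auto simp: C_def quat_circle_def)
    then show ?thesis by (simp add: Sol)
  qed
  have nonreal: "((\<forall>Y \<in> quat_plane p s. orthogonal Rt Y) \<longrightarrow>
          Sol = (if s0 * norm p = p0 * norm s then (\<lambda>Z. Z - A) ` quat_circle p s else {}))
      \<and> (\<not> (\<forall>Y \<in> quat_plane p s. orthogonal Rt Y) \<longrightarrow>
          affine (quat_plane p s \<inter> H) \<and> aff_dim (quat_plane p s \<inter> H) = 1
          \<and> Sol = (\<lambda>Z. Z - A) ` (quat_circle p s \<inter> (quat_plane p s \<inter> H))
          \<and> finite Sol \<and> card Sol \<in> {2, 1, 0})"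
    if "St \<notin> \<real>"
  proof -
    define V where "V = quat_plane p s"
    define n where "n = sgn p"
    define m where "m = sgn s"
    have s0: "s \<noteq> 0" using that assms(7) by (simp add: quat_Reals_iff)
    have n: "scal n = 0" "norm n = 1" and m: "scal m = 0" "norm m = 1"
      using p s s0 by (simp_all add: n_def m_def scal_sgn norm_sgn)
    have V: "V = intertwiners n m"
      unfolding V_def n_def m_def by (rule quat_plane_eq_intertwiners[OF p s s0])
    have C: "C = V \<inter> sphere 0 (sqrt (norm s / norm p))"
      using s0 by (simp add: C_def V_def quat_circle_def)
    have a: "Sol = (if s0 * norm p = p0 * norm s then (\<lambda>Z. Z - A) ` C else {})"
      if orth: "\<forall>Y \<in> V. orthogonal Rt Y"
    proof -
      have "Z \<in> H \<longleftrightarrow> s0 * norm p = p0 * norm s" if "Z \<in> C" for Z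
      proof -
        have "inner Z Rt = 0"
          using that orth C by (metis IntD1 inner_commute orthogonal_def)
        then show ?thesis using p(2) by (simp add: assms(10))
      qed
      then have "C \<inter> H = (if s0 * norm p = p0 * norm s then C else {})" by auto
      then show ?thesis by (simp add: Sol)
    qed
    have b: "affine (V \<inter> H) \<and> aff_dim (V \<inter> H) = 1
          \<and> Sol = (\<lambda>Z. Z - A) ` (C \<inter> (V \<inter> H)) \<and> finite Sol \<and> card Sol \<in> {2, 1, 0}"
      if north: "\<not> (\<forall>Y \<in> V. orthogonal Rt Y)"
    proof -
      define c where "c = (s0 * norm p - p0 * norm s) / (2 * norm p)"
      obtain f where f: "f \<in> V" "norm f = 1" "inner Rt f = 0" "inner Rt (f * n) \<noteq> 0"
        using intertwiners_adapted_vector[OF n m] north unfolding V by metis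
      define e where "e = f * n"
      have e: "e \<in> V" "norm e = 1" "inner e f = 0"
        using f(1,2) n intertwiners_mult_right[of f n m] inner_mult_right_pure[of n f]
        by (simp_all add: e_def V norm_mult inner_commute)
      have H: "H = {Z. inner Rt Z = c}"
        by (simp add: assms(10) c_def inner_commute)
      have subV: "subspace V" by (simp add: V subspace_intertwiners)
      have affV: "affine V" using subV by (rule subspace_imp_affine)
      have "affine (V \<inter> H)"
        unfolding H by (intro affine_Int affV affine_hyperplane)
      moreover have "aff_dim (V \<inter> H) = 1"
      proof -
        have scaled: "t *\<^sub>R e \<in> V" for t
          using subV e(1) by (rule subspace_scale)
        \<comment> \<open>Along \<open>e\<close> the product with \<open>Rt\<close> takes all values: the hyperplane meets \<open>V\<close> without
          containing it, so it lowers the dimension by exactly one.\<close>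
        have "(c / inner Rt e) *\<^sub>R e \<in> V \<inter> H" "((c + 1) / inner Rt e) *\<^sub>R e \<in> V - H"
          using scaled f(4) by (simp_all add: H e_def)
        then have "V \<inter> H \<noteq> {}" "\<not> V \<subseteq> H" by blast+
        moreover have "aff_dim V = 2"
          using aff_dim_subspace[OF subV] dim_intertwiners[OF n m] by (simp add: V)
        ultimately show ?thesis
          unfolding H by (simp add: aff_dim_affine_Int_hyperplane[OF affV])
      qed
      moreover have "Sol = (\<lambda>Z. Z - A) ` (C \<inter> (V \<inter> H))"
        using Sol C by (metis inf.assoc inf.right_idem inf.commute)
      moreover have "finite Sol \<and> card Sol \<in> {2, 1, 0}"
      proof -
        have "f \<noteq> 0" using f(2) by auto
        then have coords: "\<exists>x y. Z = x *\<^sub>R e + y *\<^sub>R f" if "Z \<in> V" for Z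
          using that f(1) intertwiners_iff[OF n, of f m Z]
          by (metis V add.commute e_def)
        have "finite (C \<inter> H) \<and> card (C \<inter> H) \<le> 2"
          by (rule circle_meets_line_card_le_2[of e f Rt _ "sqrt (norm s / norm p)" c])
            (use e f coords in \<open>auto simp: C H e_def[symmetric] inner_commute\<close>)
        moreover have "card Sol = card (C \<inter> H)"
          unfolding Sol by (rule card_image) (simp add: inj_on_def)
        moreover have "k \<in> {2, 1, 0}" if "k \<le> 2" for k :: nat
          using that by auto
        ultimately show ?thesis using Sol by (metis finite_imageI)
      qed
      ultimately show ?thesis by blast
    qed
    show ?thesis using a b unfolding V_def C_def by blast
  qed
  show ?thesis
    using Sol zero real nonreal unfolding C_def by blast
qed

end
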